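(* For all integers $n\geq 1$ and $k\geq 1$, the polynomial $S_{n,k}(z)$ satisfies \[ S_{n,k}(1-z) = (-1)^{(k+1)(n+1)-1}S_{n,k}(z), \] and is divisible (as a polynomial in $z$ with rational coefficients) by \[ z\prod_{j=1}^{n+1}\bigl((n+1)z-j\bigr). \]
   Context: The Bernoulli polynomials $B_k(z)$ are defined by $\frac{xe^{zx}}{e^x-1}=\sum_{k=0}^\infty B_k(z)\frac{x^k}{k!}$, $|x|<2\pi$. For integers $n\geq 1$ and $k\geq 0$ define the polynomial \[ S_{n,k}(z):=\sum_{m=1}^n\binom{n+1}{m}(k!)^{n-m}(-1)^{km}\sum_{\substack{j_1,\ldots,j_m\geq 0\\ j_1+\dots+j_m=(k+1)(n-m)+k}}\ \prod_{i=1}^m\frac{B_{k+1+j_i}(z)}{j_i!\,(k+1+j_i)}, \] where the $j_i$ are integers. *)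

theory Defs
  imports
    "HOL-Complex_Analysis.Complex_Analysis"
    "HOL-Computational_Algebra.Computational_Algebra"
begin

text \<open>
  The generating function is read as a formal power series in \<open>x\<close> for each fixed \<open>z\<close>; the lemmas
  \<open>poly_bernoulli_poly\<close> and \<open>bernoulli_poly_sums\<close> show that the description is satisfied
  by a polynomial and that it gives the convergent series expansion for complex \<open>z\<close> and
  \<open>0 < \<bar>x\<bar> < 2\<pi>\<close>.
\<close>

definition bernoulli_poly :: "nat \<Rightarrow> rat poly" where
  "bernoulli_poly k =
     (THE p. \<forall>z. poly p z = fact k * fps_nth (fps_X * fps_exp z / (fps_exp 1 - 1)) k)"

lemma fps_exp_1_minus_1:
  "subdegree (fps_exp 1 - 1 :: 'a :: field_char_0 fps) = 1"
  "(fps_exp 1 - 1 :: 'a fps) \<noteq> 0"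
  "(fps_exp 1 - 1 :: 'a fps) dvd fps_X"
proof -
  show *: "subdegree (fps_exp 1 - 1 :: 'a fps) = 1"
    by (rule subdegreeI) auto
  show **: "(fps_exp 1 - 1 :: 'a fps) \<noteq> 0"
    using * by (metis subdegree_0 zero_neq_one)
  show "(fps_exp 1 - 1 :: 'a fps) dvd fps_X"
    using * ** by (subst fps_dvd_iff) auto
qed

lemma of_rat_fact: "of_rat (fact n) = (fact n :: 'a :: field_char_0)"
  by (metis of_nat_fact of_rat_of_nat_eq)

lemma fps_nth_bernoulli_gf:
  fixes z :: "'a :: field_char_0"
  shows "fps_nth (fps_X * fps_exp z / (fps_exp 1 - 1)) k =
           (\<Sum>i\<le>k. of_rat (fps_nth (fps_X / (fps_exp 1 - 1)) i) * z ^ (k - i) / fact (k - i))"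
proof -
  define g :: "rat fps" where "g = fps_X / (fps_exp 1 - 1)"
  define h :: "'a fps" where "h = Abs_fps (\<lambda>i. of_rat (fps_nth g i))"
  have g: "g * (fps_exp 1 - 1) = fps_X"
    unfolding g_def by (intro dvd_div_mult_self fps_exp_1_minus_1)
  have "h * (fps_exp 1 - 1) = fps_X"
  proof (rule fps_ext)
    fix n
    have "fps_nth (h * (fps_exp 1 - 1)) n = of_rat (fps_nth (g * (fps_exp 1 - 1)) n)"
      by (auto simp: fps_mult_nth h_def of_rat_sum of_rat_mult of_rat_diff of_rat_divide
                     of_rat_inverse of_rat_fact intro!: sum.cong)
    thus "fps_nth (h * (fps_exp 1 - 1)) n = fps_nth fps_X n"
      by (simp add: g)
  qed
  hence h: "fps_X / (fps_exp 1 - 1) = h"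
    using fps_exp_1_minus_1(2)[where ?'a = 'a] by (metis nonzero_mult_div_cancel_right)
  have "fps_X * fps_exp z / (fps_exp 1 - 1) = h * fps_exp z"
    using fps_exp_1_minus_1(3)[where ?'a = 'a] by (simp add: dvd_div_mult flip: h)
  thus ?thesis
    by (simp add: fps_mult_nth h_def g_def atLeast0AtMost)
qed

lemma bernoulli_poly_eq:
  "bernoulli_poly k =
     (\<Sum>i\<le>k. monom (fact k * fps_nth (fps_X / (fps_exp 1 - 1)) i / fact (k - i)) (k - i))"
  (is "_ = ?p")
proof -
  have p: "poly ?p z = fact k * fps_nth (fps_X * fps_exp z / (fps_exp 1 - 1)) k" for z
    unfolding fps_nth_bernoulli_gf
    by (auto simp: poly_sum poly_monom sum_distrib_left intro!: sum.cong)
  show ?thesis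
    unfolding bernoulli_poly_def
  proof (rule the_equality)
    fix q :: "rat poly"
    assume "\<forall>z. poly q z = fact k * fps_nth (fps_X * fps_exp z / (fps_exp 1 - 1)) k"
    hence "poly q = poly ?p"
      using p by auto
    thus "q = ?p"
      by (simp only: poly_eq_poly_eq_iff)
  qed (use p in auto)
qed

lemma poly_of_rat_bernoulli_poly:
  fixes z :: "'a :: field_char_0"
  shows "poly (map_poly of_rat (bernoulli_poly k)) z =
           fact k * fps_nth (fps_X * fps_exp z / (fps_exp 1 - 1)) k"
proof -
  have "map_poly of_rat (bernoulli_poly k) =
          (\<Sum>i\<le>k. monom (fact k * of_rat (fps_nth (fps_X / (fps_exp 1 - 1)) i) / fact (k - i) :: 'a)
                    (k - i))"
    by (rule poly_eqI)
       (simp add: bernoulli_poly_eq coeff_map_poly coeff_sum of_rat_sum coeff_monom if_distrib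
                  of_rat_mult of_rat_divide of_rat_fact cong: if_cong)
  thus ?thesis
    unfolding fps_nth_bernoulli_gf
    by (auto simp: poly_sum poly_monom sum_distrib_left intro!: sum.cong)
qed

lemma poly_bernoulli_poly:
  "poly (bernoulli_poly k) z = fact k * fps_nth (fps_X * fps_exp z / (fps_exp 1 - 1)) k"
  using poly_of_rat_bernoulli_poly[of k z] by (simp add: map_poly_idI)

lemma bernoulli_poly_sums:
  fixes x z :: complex
  assumes x: "x \<noteq> 0" "norm x < 2 * pi"
  shows "(\<lambda>k. poly (map_poly of_rat (bernoulli_poly k)) z * x ^ k / fact k)
           sums (x * exp (z * x) / (exp x - 1))"
proof -
  define f g :: "complex fps" where "f = fps_X * fps_exp z" and "g = fps_exp 1 - 1"
  have radius: "fps_conv_radius f = \<infinity>" "fps_conv_radius g = \<infinity>"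
  proof -
    have "fps_conv_radius f \<ge> min (fps_conv_radius (fps_X :: complex fps)) (fps_conv_radius (fps_exp z))"
      unfolding f_def by (rule fps_conv_radius_mult)
    thus "fps_conv_radius f = \<infinity>" by simp
    have "fps_conv_radius g \<ge> min (fps_conv_radius (fps_exp (1 :: complex))) (fps_conv_radius (1 :: complex fps))"
      unfolding g_def by (rule fps_conv_radius_diff)
    thus "fps_conv_radius g = \<infinity>" by simp
  qed
  have eval_f: "eval_fps f w = w * exp (z * w)" for w
    unfolding f_def by (subst eval_fps_mult) auto
  have eval_g: "eval_fps g w = exp w - 1" for w
    unfolding g_def by (subst eval_fps_diff) auto
  have nz: "eval_fps g w \<noteq> 0" if w: "w \<in> eball 0 (ereal (2 * pi))" "w \<noteq> 0" for w
  proof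
    assume "eval_fps g w = 0"
    hence "exp w = 1"
      by (simp add: eval_g)
    then obtain n :: int where n: "Re w = 0" "Im w = of_int (2 * n) * pi"
      unfolding exp_eq_1 by blast
    with w(2) have "n \<noteq> 0"
      by (auto simp: complex_eq_iff)
    hence "1 \<le> \<bar>real_of_int n\<bar>"
      by linarith
    hence "2 * pi * 1 \<le> 2 * pi * \<bar>real_of_int n\<bar>"
      by (intro mult_left_mono) auto
    also have "\<dots> = \<bar>Im w\<bar>"
      by (simp add: n abs_mult)
    also have "\<dots> \<le> norm w"
      by (rule abs_Im_le_cmod)
    finally show False
      using w(1) by simp
  qed
  have deg: "subdegree g = 1" "subdegree f = 1"
    by (simp add: g_def fps_exp_1_minus_1, rule subdegreeI) (auto simp: f_def)
  have R: "Min {ereal (2 * pi), fps_conv_radius f, fps_conv_radius g} = ereal (2 * pi)"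
    by (simp add: radius min_def)
  have "fps_conv_radius (f / g) \<ge> ereal (2 * pi)"
    using fps_conv_radius_divide[of g f "ereal (2 * pi)"] nz deg by (simp add: radius R)
  hence "ereal (norm x) < fps_conv_radius (f / g)"
    using x(2) by (metis ereal_less_eq(3) less_le_trans linorder_not_less)
  hence "(\<lambda>k. fps_nth (f / g) k * x ^ k) sums eval_fps (f / g) x"
    by (rule sums_eval_fps)
  also have "eval_fps (f / g) x = eval_fps f x / eval_fps g x"
    using eval_fps_divide[of g f "ereal (2 * pi)" x, OF _ _ _ _ _ _ refl] nz deg x
    by (simp add: radius R)
  finally show ?thesis
    by (simp add: poly_of_rat_bernoulli_poly f_def g_def eval_f [unfolded f_def] eval_g [unfolded g_def])
qed

text \<open>
  \<^term>\<open>natpermute N m\<close> is the set of lists of \<open>m\<close> natural numbers with sum \<open>N\<close>, so \<open>js\<close> ranges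
  over the tuples \<open>(j\<^sub>1, \<dots>, j\<^sub>m)\<close>, indexed from \<open>0\<close>.
\<close>

definition S_poly :: "nat \<Rightarrow> nat \<Rightarrow> rat poly" where
  "S_poly n k =
     (\<Sum>m=1..n.
        smult (of_nat ((n + 1) choose m) * fact k ^ (n - m) * (-1) ^ (k * m))
          (\<Sum>js\<in>natpermute ((k + 1) * (n - m) + k) m.
             \<Prod>i<m. smult (1 / (fact (js ! i) * of_nat (k + 1 + js ! i)))
                           (bernoulli_poly (k + 1 + js ! i))))"

end

theory Submission
  imports Defs
begin

text \<open>
  Let \<open>F = e\<^sup>z\<^sup>x / (e\<^sup>x - 1)\<close>, a formal Laurent series in \<open>x\<close>. Differentiating its Bernoulli expansion
  \<open>k\<close> times gives a polar part \<open>(-1)\<^sup>k k! x\<^sup>-\<^sup>k\<^sup>-\<^sup>1\<close> plus a power series whose coefficients are the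
  factors \<open>B\<^bsub>k+1+j\<^esub>(z) / (j! (k+1+j))\<close> of \<open>S\<^bsub>n,k\<^esub>\<close>. Expanding the \<open>(n+1)\<close>-st power of \<open>F\<^sup>(\<^sup>k\<^sup>)\<close>
  binomially and reading off the coefficient of \<open>x\<^sup>-\<^sup>1\<close> therefore gives \<open>S\<^bsub>n,k\<^esub>(z)\<close>, up to a nonzero
  constant (\<open>residue_eq_poly_S_poly\<close>). The divisibility claim becomes the vanishing of a residue at
  the \<open>n + 2\<close> distinct points \<open>z = j / (n + 1)\<close>, \<open>0 \<le> j \<le> n + 1\<close>.

  Put \<open>u = 1 / (e\<^sup>x - 1)\<close>, so that \<open>u' = -(u + u\<^sup>2)\<close> and \<open>e\<^sup>x u = 1 + u\<close>. By the first relation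
  \<open>F\<^sup>(\<^sup>k\<^sup>) = e\<^sup>z\<^sup>x p(u)\<close> for a polynomial \<open>p\<close> without constant term. At \<open>z = j / (n + 1)\<close> with
  \<open>1 \<le> j \<le> n\<close> the exponential factor of the power is the integral power \<open>(e\<^sup>x)\<^sup>j\<close>, and \<open>j\<close> of the
  \<open>n + 1\<close> available factors \<open>u\<close> absorb it by the second relation. What remains is a polynomial in \<open>u\<close>
  divisible by \<open>u (1 + u)\<close>, that is, \<open>u'\<close> times a polynomial in \<open>u\<close>. This is a derivative, so its
  residue is zero (\<open>residue_higher_deriv_exp_recip_expm1_power\<close>). For \<open>z = 0\<close> there is no exponential
  factor, and \<open>p\<close> itself is divisible by \<open>u (1 + u)\<close> as soon as \<open>k \<ge> 1\<close>.

  The point \<open>z = 1\<close> is the mirror image of \<open>z = 0\<close> under the symmetry of \<open>S\<^bsub>n,k\<^esub>\<close>. That symmetry is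
  inherited from \<open>B\<^sub>r(1 - z) = (-1)\<^sup>r B\<^sub>r(z)\<close>, since in every product of the sum the indices
  \<open>k + 1 + j\<^sub>i\<close> add up to the same number \<open>(k + 1)(n + 1) - 1\<close>.
\<close>

section \<open>Polynomials in a Laurent series\<close>

definition poly_fls :: "'a :: field_char_0 poly \<Rightarrow> 'a fls \<Rightarrow> 'a fls" where
  "poly_fls p f = poly (map_poly fls_const p) f"

lemma poly_fls_0 [simp]: "poly_fls 0 f = 0"
  by (simp add: poly_fls_def)

lemma poly_fls_pCons [simp]: "poly_fls (pCons a p) f = fls_const a + f * poly_fls p f"
  by (cases "a = 0 \<and> p = 0") (auto simp: poly_fls_def map_poly_pCons)

lemma poly_fls_1 [simp]: "poly_fls 1 f = 1"
  by (simp add: one_pCons)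

lemma poly_fls_add: "poly_fls (p + q) f = poly_fls p f + poly_fls q f"
  by (induction p q rule: poly_induct2) (auto simp: algebra_simps fls_plus_const)

lemma poly_fls_smult: "poly_fls (smult c p) f = fls_const c * poly_fls p f"
  by (induction p) (auto simp: algebra_simps)

lemma poly_fls_mult: "poly_fls (p * q) f = poly_fls p f * poly_fls q f"
  by (induction p) (auto simp: algebra_simps poly_fls_add poly_fls_smult)

lemma poly_fls_power: "poly_fls (p ^ n) f = poly_fls p f ^ n"
  by (induction n) (auto simp: poly_fls_mult)

lemma poly_fls_diff: "poly_fls (p - q) f = poly_fls p f - poly_fls q f"
  using poly_fls_add[of "p - q" q f] by simp

lemma fls_deriv_poly_fls:
  "fls_deriv (poly_fls p f) = poly_fls (pderiv p) f * fls_deriv f"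
  by (induction p) (auto simp: pderiv_pCons poly_fls_add algebra_simps)

lemma pderiv_surj: "\<exists>q. pderiv q = (p :: 'a :: field_char_0 poly)"
proof
  have "of_nat (Suc i) \<noteq> (0 :: 'a)" for i
    by (rule of_nat_neq_0)
  thus "pderiv (\<Sum>i\<le>degree p. monom (coeff p i / of_nat (Suc i)) (Suc i)) = p"
    using higher_pderiv_sum[of 1 "\<lambda>i. monom (coeff p i / of_nat (Suc i)) (Suc i)" "{..degree p}"]
    by (simp add: pderiv_monom poly_as_sum_of_monoms del: of_nat_Suc)
qed

section \<open>Derivatives of \<open>e\<^sup>z\<^sup>x / (e\<^sup>x - 1)\<close>\<close>

definition exp_fls :: "'a :: field_char_0 \<Rightarrow> 'a fls" where
  "exp_fls z = fps_to_fls (fps_exp z)"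

definition recip_expm1 :: "'a :: field_char_0 fls" where
  "recip_expm1 = inverse (exp_fls 1 - 1)"

lemma exp_fls_power: "exp_fls z ^ n = exp_fls (of_nat n * z)"
  by (simp add: exp_fls_def fps_exp_power_mult flip: fps_to_fls_power)

lemma fls_deriv_exp_fls: "fls_deriv (exp_fls z) = fls_const z * exp_fls z"
  by (simp add: exp_fls_def fls_deriv_fps_to_fls fls_times_fps_to_fls)

lemma exp_fls_1_minus_1: "exp_fls (1 :: 'a :: field_char_0) - 1 = fps_to_fls (fps_exp 1 - 1)"
  by (simp add: exp_fls_def)

lemma recip_expm1_inverse: "recip_expm1 * (exp_fls (1 :: 'a :: field_char_0) - 1) = 1"
proof -
  have "exp_fls (1 :: 'a) - 1 \<noteq> 0"
    unfolding exp_fls_1_minus_1 using fps_exp_1_minus_1(2) by (simp del: fps_to_fls_minus)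
  thus ?thesis
    by (simp add: recip_expm1_def)
qed

lemma exp_fls_1_recip_expm1: "exp_fls 1 * recip_expm1 = 1 + recip_expm1"
  using recip_expm1_inverse by (simp add: algebra_simps)

lemma fls_deriv_recip_expm1: "fls_deriv recip_expm1 = - (recip_expm1 + recip_expm1 ^ 2)"
proof -
  have "fls_deriv (recip_expm1 * (exp_fls 1 - 1)) = fls_deriv (1 :: 'a fls)"
    by (simp only: recip_expm1_inverse)
  hence "fls_deriv recip_expm1 * (exp_fls 1 - 1) = - (exp_fls 1 * recip_expm1 :: 'a fls)"
    by (simp add: fls_deriv_exp_fls algebra_simps add_eq_0_iff)
  hence "recip_expm1 * (fls_deriv recip_expm1 * (exp_fls 1 - 1)) = - (recip_expm1 * (1 + recip_expm1) :: 'a fls)"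
    by (simp only: exp_fls_1_recip_expm1 mult_minus_right)
  moreover have "recip_expm1 * (fls_deriv recip_expm1 * (exp_fls 1 - 1)) = fls_deriv recip_expm1 * (recip_expm1 * (exp_fls 1 - 1) :: 'a fls)"
    by (simp only: mult_ac)
  ultimately have "fls_deriv recip_expm1 * 1 = - (recip_expm1 * (1 + recip_expm1) :: 'a fls)"
    by (simp only: recip_expm1_inverse)
  thus ?thesis
    by (simp add: algebra_simps power2_eq_square)
qed

text \<open>
  As \<open>u' = -(u + u\<^sup>2)\<close> for \<open>u = 1 / (e\<^sup>x - 1)\<close>, the series \<open>(u + u\<^sup>2) q(u)\<close> is the derivative of \<open>-r(u)\<close>
  when \<open>r\<close> is an antiderivative of the polynomial \<open>q\<close>.
\<close>

lemma residue_poly_recip_expm1: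
  assumes "[:0, 1, 1:] dvd p"
  shows   "fls_residue (poly_fls p recip_expm1) = 0"
proof -
  obtain q where q: "p = [:0, 1, 1:] * q"
    using assms by (elim dvdE)
  obtain r where r: "pderiv r = q"
    using pderiv_surj by blast
  have "poly_fls p recip_expm1 = - fls_deriv (poly_fls r recip_expm1)"
    by (simp only: q poly_fls_mult fls_deriv_poly_fls r fls_deriv_recip_expm1)
       (simp add: algebra_simps power2_eq_square)
  thus ?thesis
    by simp
qed

text \<open>
  Differentiation turns \<open>e\<^sup>z\<^sup>x p(u)\<close> into \<open>e\<^sup>z\<^sup>x (z p(u) - (u + u\<^sup>2) p'(u))\<close>, which preserves divisibility
  of the polynomial by \<open>u\<close>. For \<open>z = 0\<close> the first summand disappears, so that a single derivative
  already produces the factor \<open>u (1 + u)\<close>.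
\<close>

lemma higher_deriv_exp_recip_expm1:
  fixes z :: "'a :: field_char_0"
  shows "\<exists>p. (fls_deriv ^^ k) (exp_fls z * recip_expm1) = exp_fls z * poly_fls p recip_expm1 \<and> [:0, 1:] dvd p \<and>
             (z = 0 \<and> k \<ge> 1 \<longrightarrow> [:0, 1, 1:] dvd p)"
proof (induction k)
  case 0
  show ?case
    by (rule exI[of _ "[:0, 1:]"]) simp
next
  case (Suc k)
  then obtain p where p: "(fls_deriv ^^ k) (exp_fls z * recip_expm1) = exp_fls z * poly_fls p recip_expm1"
    "[:0, 1:] dvd p"
    by blast
  define q where "q = smult z p - [:0, 1, 1:] * pderiv p"
  have "(fls_deriv ^^ Suc k) (exp_fls z * recip_expm1) = exp_fls z * poly_fls q recip_expm1"
    by (simp only: q_def poly_fls_diff poly_fls_smult poly_fls_mult funpow.simps o_apply p(1)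
          fls_deriv_mult fls_deriv_exp_fls fls_deriv_poly_fls fls_deriv_recip_expm1)
       (simp add: algebra_simps power2_eq_square)
  moreover have "[:0, 1, 1:] = [:0, 1:] * [:1, 1 :: 'a:]"
    by simp
  hence "[:0, 1:] dvd [:0, 1, 1 :: 'a:]"
    by (metis dvd_triv_left)
  hence "[:0, 1:] dvd q"
    unfolding q_def using p(2) by (intro dvd_diff dvd_smult dvd_mult2)
  moreover have "[:0, 1, 1:] dvd q" if "z = 0"
  proof -
    have "q = [:0, 1, 1:] * - pderiv p"
      using that by (simp add: q_def)
    thus ?thesis
      by (metis dvd_triv_left)
  qed
  ultimately show ?case
    by blast
qed

text \<open>
  The hypothesis on \<open>z\<close> makes the exponential factor \<open>e\<^sup>(\<^sup>n\<^sup>+\<^sup>1\<^sup>)\<^sup>z\<^sup>x\<close> equal to \<open>(e\<^sup>x)\<^sup>j\<close>. Writing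
  \<open>p = u r\<close>, one obtains
  \<open>(e\<^sup>x)\<^sup>j u\<^sup>n\<^sup>+\<^sup>1 r(u)\<^sup>n\<^sup>+\<^sup>1 = (1 + u)\<^sup>j u\<^sup>n\<^sup>+\<^sup>1\<^sup>-\<^sup>j r(u)\<^sup>n\<^sup>+\<^sup>1\<close>, and both exponents are positive exactly
  when \<open>1 \<le> j \<le> n\<close>. If \<open>j = 0\<close>, then \<open>z = 0\<close>, and \<open>p\<close> already contains the factor \<open>u (1 + u)\<close>.
\<close>

lemma residue_higher_deriv_exp_recip_expm1_power:
  fixes z :: "'a :: field_char_0"
  assumes z: "of_nat (n + 1) * z = of_nat j" and "j \<le> n" and "k \<ge> 1"
  shows "fls_residue ((fls_deriv ^^ k) (exp_fls z * recip_expm1) ^ (n + 1)) = 0"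
proof -
  obtain p where p: "(fls_deriv ^^ k) (exp_fls z * recip_expm1) = exp_fls z * poly_fls p recip_expm1"
    "[:0, 1:] dvd p" "z = 0 \<and> k \<ge> 1 \<longrightarrow> [:0, 1, 1:] dvd p"
    using higher_deriv_exp_recip_expm1 by blast
  have *: "(fls_deriv ^^ k) (exp_fls z * recip_expm1) ^ (n + 1) = exp_fls 1 ^ j * poly_fls p recip_expm1 ^ (n + 1)"
    by (simp only: p(1) power_mult_distrib exp_fls_power z) simp
  show ?thesis
  proof (cases "j = 0")
    case True
    hence "z = 0"
      using z by (metis mult_eq_0_iff of_nat_0 of_nat_eq_0_iff add_is_0 one_neq_zero)
    hence "[:0, 1, 1:] dvd p ^ (n + 1)"
      using p(3) \<open>k \<ge> 1\<close> by (simp add: dvd_mult2)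
    thus ?thesis
      using True residue_poly_recip_expm1 by (simp only: * poly_fls_power[symmetric]) simp
  next
    case False
    obtain r where r: "p = [:0, 1:] * r"
      using p(2) by (elim dvdE)
    \<comment> \<open>The polynomial left after \<open>(e\<^sup>x u)\<^sup>j\<close> has been replaced by \<open>(1 + u)\<^sup>j\<close>.\<close>
    define q where "q = [:1, 1:] ^ j * [:0, 1:] ^ (n + 1 - j) * r ^ (n + 1)"
    have "exp_fls 1 ^ j * poly_fls p recip_expm1 ^ (n + 1) =
            exp_fls 1 ^ j * recip_expm1 ^ (n + 1) * poly_fls r recip_expm1 ^ (n + 1)"
      by (simp only: r poly_fls_mult power_mult_distrib) simp
    also have "recip_expm1 ^ (n + 1) = recip_expm1 ^ j * (recip_expm1 ^ (n + 1 - j) :: 'a fls)"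
      using \<open>j \<le> n\<close> by (simp flip: power_add)
    also have "exp_fls 1 ^ j * (recip_expm1 ^ j * recip_expm1 ^ (n + 1 - j)) * poly_fls r recip_expm1 ^ (n + 1) =
               (exp_fls 1 * recip_expm1) ^ j * recip_expm1 ^ (n + 1 - j) * poly_fls r recip_expm1 ^ (n + 1)"
      by (simp only: power_mult_distrib mult_ac)
    also have "\<dots> = poly_fls q recip_expm1"
      by (simp only: q_def poly_fls_mult poly_fls_power exp_fls_1_recip_expm1) simp
    finally have "exp_fls 1 ^ j * poly_fls p recip_expm1 ^ (n + 1) = poly_fls q recip_expm1" .
    moreover have "[:0, 1, 1:] dvd q"
    proof -
      have "[:1, 1:] * [:0, 1:] dvd [:1, 1:] ^ j * ([:0, 1:] ^ (n + 1 - j) :: 'a poly)"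
        using False \<open>j \<le> n\<close> by (intro mult_dvd_mono dvd_power) auto
      hence "[:1, 1:] * [:0, 1:] dvd q"
        unfolding q_def by (rule dvd_mult2)
      thus ?thesis
        by simp
    qed
    ultimately show ?thesis
      using residue_poly_recip_expm1 by (simp only: *)
  qed
qed

section \<open>The sum as a residue\<close>

text \<open>
  This is the regular part of the \<open>k\<close>-th derivative of \<open>e\<^sup>z\<^sup>x / (e\<^sup>x - 1)\<close>, as
  \<open>higher_deriv_exp_recip_expm1_expansion\<close> shows.
\<close>

definition bernoulli_tail :: "rat \<Rightarrow> nat \<Rightarrow> rat fps" where
  "bernoulli_tail z k =
     Abs_fps (\<lambda>j. poly (bernoulli_poly (k + 1 + j)) z / (fact j * of_nat (k + 1 + j)))"

lemma fps_deriv_bernoulli_tail: "fps_deriv (bernoulli_tail z k) = bernoulli_tail z (Suc k)"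
  by (rule fps_ext) (simp add: bernoulli_tail_def divide_simps del: of_nat_Suc of_nat_add)

lemma exp_recip_expm1_expansion: "exp_fls z * recip_expm1 = fls_X_inv + fps_to_fls (bernoulli_tail z 0)"
proof -
  define H :: "rat fps" where "H = fps_X * fps_exp z / (fps_exp 1 - 1)"
  have H: "H * (fps_exp 1 - 1) = fps_X * fps_exp z"
    unfolding H_def by (intro dvd_div_mult_self dvd_mult2 fps_exp_1_minus_1)
  have "fps_nth (H * (fps_exp 1 - 1)) 1 = 1"
    by (subst H) simp
  hence H0: "fps_nth H 0 = 1"
    by (simp add: fps_mult_nth)
  have HS: "fps_nth H (Suc i) = fps_nth (bernoulli_tail z 0) i" for i
    unfolding bernoulli_tail_def by (simp add: poly_bernoulli_poly H_def)
  have "H = 1 + fps_X * bernoulli_tail z 0"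
  proof (rule fps_ext)
    fix i show "fps_nth H i = fps_nth (1 + fps_X * bernoulli_tail z 0) i"
      by (cases i) (simp_all add: H0 HS)
  qed
  hence "fps_to_fls H = 1 + fls_X * fps_to_fls (bernoulli_tail z 0)"
    by (simp add: fls_times_fps_to_fls)
  moreover have "fps_to_fls H * (exp_fls 1 - 1) = fls_X * exp_fls z"
    unfolding exp_fls_1_minus_1 unfolding exp_fls_def
    by (simp only: fls_times_fps_to_fls[symmetric] H fps_X_to_fls[symmetric])
  hence "fls_X * (exp_fls z * recip_expm1) = fps_to_fls H * (recip_expm1 * (exp_fls 1 - 1))"
    by (simp add: mult_ac)
  ultimately have "fls_X_inv * (fls_X * (exp_fls z * recip_expm1)) =
      fls_X_inv * (1 + fls_X * fps_to_fls (bernoulli_tail z 0))"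
    by (simp add: recip_expm1_inverse)
  moreover have "fls_X_inv * fls_X = (1 :: rat fls)"
    by (simp add: fls_X_inv_times_conv_shift)
  ultimately show ?thesis
    by (simp add: distrib_left flip: mult.assoc)
qed

lemma higher_deriv_exp_recip_expm1_expansion:
  "(fls_deriv ^^ k) (exp_fls z * recip_expm1) =
     fls_const ((-1) ^ k * fact k) * fls_X_inv ^ (k + 1) + fps_to_fls (bernoulli_tail z k)"
proof (induction k)
  case 0
  show ?case
    by (simp add: exp_recip_expm1_expansion)
next
  case (Suc k)
  have "fls_const ((-1) ^ k * fact k) * - of_nat (k + 1) = fls_const ((-1) ^ Suc k * fact (Suc k) :: rat)"
    by (simp only: fls_of_nat fls_const_mult_const fls_const_uminus[symmetric]) (simp add: algebra_simps)
  thus ?case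
    by (simp only: funpow.simps o_apply Suc fls_deriv_add fls_deriv_mult_const_left
          fls_deriv_fps_to_fls fps_deriv_bernoulli_tail fls_deriv_X_inv_power
          mult.assoc[symmetric]) simp
qed

lemma residue_X_inv_power_times:
  "fls_residue (fls_X_inv ^ N * fps_to_fls f) = (if N = 0 then 0 else fps_nth f (N - 1))"
  by (auto simp: fls_X_inv_power_times_conv_shift nat_diff_distrib)

text \<open>
  The inner sum over tuples \<open>(j\<^sub>1, \<dots>, j\<^sub>m)\<close> of prescribed sum is a coefficient of an \<open>m\<close>-fold product of
  power series; this replaces it by algebra in the ring of power series.
\<close>

lemma poly_S_poly:
  "poly (S_poly n k) z =
     (\<Sum>m=1..n. of_nat ((n + 1) choose m) * fact k ^ (n - m) * (-1) ^ (k * m) *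
        fps_nth (bernoulli_tail z k ^ m) ((k + 1) * (n - m) + k))"
proof -
  have *: "fps_nth (bernoulli_tail z k ^ m) N =
        (\<Sum>js\<in>natpermute N m. \<Prod>i<m. poly (bernoulli_poly (k + 1 + js ! i)) z /
             (fact (js ! i) * of_nat (k + 1 + js ! i)))" if "m \<ge> 1" for m N
  proof -
    have "{0..m - 1} = {..<m}"
      using that by auto
    thus ?thesis
      using that by (simp add: fps_power_nth bernoulli_tail_def)
  qed
  show ?thesis
    unfolding S_poly_def poly_sum poly_smult poly_prod
    by (intro sum.cong refl arg_cong2[where f = "(*)"]) (simp add: *)
qed

text \<open>
  Let \<open>G\<close> be the power series \<open>bernoulli_tail z k\<close>.
  In the binomial expansion of \<open>((-1)\<^sup>k k! x\<^sup>-\<^sup>k\<^sup>-\<^sup>1 + G)\<^sup>n\<^sup>+\<^sup>1\<close> the term with \<open>G\<^sup>m\<close> contributes the coefficient of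
  \<open>G\<^sup>m\<close> at \<open>(k + 1)(n + 1 - m) - 1 = (k + 1)(n - m) + k\<close>, the prescribed sum of the \<open>j\<^sub>i\<close>. The two
  extreme terms contribute nothing: for \<open>m = n + 1\<close> there is no pole, and for \<open>m = 0\<close> the term is a
  multiple of a single power of \<open>x\<close> whose exponent is at most \<open>-2\<close>.
\<close>

lemma residue_eq_poly_S_poly:
  assumes "k \<ge> 1"
  shows "fls_residue ((fls_deriv ^^ k) (exp_fls z * recip_expm1) ^ (n + 1)) =
     (-1) ^ (k * (n + 1)) * fact k * poly (S_poly n k) z"
proof -
  define c :: rat where "c = (-1) ^ k * fact k"
  define G where "G = bernoulli_tail z k"
  define t where "t m = of_nat ((n + 1) choose m) * c ^ (n + 1 - m) *
    fls_residue (fls_X_inv ^ ((k + 1) * (n + 1 - m)) * fps_to_fls (G ^ m))" for m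
  have "(fls_deriv ^^ k) (exp_fls z * recip_expm1) ^ (n + 1) =
          (fps_to_fls G + fls_const c * fls_X_inv ^ (k + 1)) ^ (n + 1)"
    by (simp only: higher_deriv_exp_recip_expm1_expansion c_def G_def add.commute)
  also have "\<dots> = (\<Sum>m\<le>n + 1. of_nat ((n + 1) choose m) * fps_to_fls G ^ m *
                       (fls_const c * fls_X_inv ^ (k + 1)) ^ (n + 1 - m))"
    by (rule binomial_ring)
  also have "\<dots> = (\<Sum>m\<le>n + 1. fls_const (of_nat ((n + 1) choose m) * c ^ (n + 1 - m)) *
                       (fls_X_inv ^ ((k + 1) * (n + 1 - m)) * fps_to_fls (G ^ m)))"
    by (intro sum.cong refl)
       (simp only: power_mult_distrib power_mult fps_to_fls_power fls_const_mult_const[symmetric]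
          fls_const_power fls_of_nat mult_ac)
  also have "fls_residue \<dots> = (\<Sum>m\<le>n + 1. t m)"
    by (simp add: fls_nth_sum t_def)
  also have "\<dots> = (\<Sum>m=1..n. t m)"
  proof (rule sum.mono_neutral_right)
    have "t 0 = 0"
      using \<open>k \<ge> 1\<close>
      unfolding t_def by (subst residue_X_inv_power_times) simp
    moreover have "t (n + 1) = 0"
      unfolding t_def by (subst residue_X_inv_power_times) simp
    moreover have "{..n + 1} - {1..n} = {0, n + 1}"
      by auto
    ultimately show "\<forall>m\<in>{..n + 1} - {1..n}. t m = 0"
      by simp
  qed auto
  also have "\<dots> = (\<Sum>m=1..n. (-1) ^ (k * (n + 1)) * fact k *
     (of_nat ((n + 1) choose m) * fact k ^ (n - m) * (-1) ^ (k * m) *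
        fps_nth (G ^ m) ((k + 1) * (n - m) + k)))"
  proof (intro sum.cong refl)
    fix m assume m: "m \<in> {1..n}"
    have "c ^ (n + 1 - m) = (-1) ^ (k * (n + 1 - m)) * (fact k * fact k ^ (n - m))"
      using m by (simp add: c_def power_mult_distrib Suc_diff_le flip: power_mult power_add)
    also have "(-1) ^ (k * (n + 1 - m)) = ((-1) ^ (k * (n + 1)) * (-1) ^ (k * m) :: rat)"
    proof -
      obtain d where "n = m + d"
        using m by (auto simp: le_iff_add)
      hence "k * (n + 1) + k * m = k * (n + 1 - m) + 2 * (k * m)"
        by (simp add: algebra_simps)
      hence "(-1) ^ (k * (n + 1)) * (-1) ^ (k * m) = ((-1) ^ (k * (n + 1 - m) + 2 * (k * m)) :: rat)"
        by (simp only: power_add[symmetric])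
      thus ?thesis
        by (simp add: power_add)
    qed
    finally have c: "c ^ (n + 1 - m) = (-1) ^ (k * (n + 1)) * (-1) ^ (k * m) * (fact k * fact k ^ (n - m))" .
    have "(k + 1) * (n + 1 - m) = Suc ((k + 1) * (n - m) + k)"
      using m by (simp add: Suc_diff_le algebra_simps)
    hence "fls_residue (fls_X_inv ^ ((k + 1) * (n + 1 - m)) * fps_to_fls (G ^ m)) =
           fps_nth (G ^ m) ((k + 1) * (n - m) + k)"
      by (simp only: residue_X_inv_power_times) simp
    thus "t m = (-1) ^ (k * (n + 1)) * fact k *
     (of_nat ((n + 1) choose m) * fact k ^ (n - m) * (-1) ^ (k * m) *
        fps_nth (G ^ m) ((k + 1) * (n - m) + k))"
      unfolding t_def c by (simp only: mult_ac)
  qed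
  finally show ?thesis
    by (simp add: poly_S_poly G_def flip: sum_distrib_left)
qed

section \<open>Reflection at \<open>1/2\<close>\<close>

text \<open>
  Replacing \<open>x\<close> by \<open>-x\<close> in \<open>x e\<^sup>z\<^sup>x / (e\<^sup>x - 1)\<close> and multiplying numerator and denominator by \<open>e\<^sup>x\<close> gives
  the same expression with \<open>1 - z\<close> for \<open>z\<close>.
\<close>

lemma poly_bernoulli_poly_reflect:
  "poly (bernoulli_poly r) (1 - z) = (-1) ^ r * poly (bernoulli_poly r) z"
proof -
  define H :: "rat \<Rightarrow> rat fps" where "H z = fps_X * fps_exp z / (fps_exp 1 - 1)" for z
  have H: "H z * (fps_exp 1 - 1) = fps_X * fps_exp z" for z
    unfolding H_def by (intro dvd_div_mult_self dvd_mult2 fps_exp_1_minus_1)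
  have exp_neg: "fps_exp a * fps_exp (- a) = (1 :: rat fps)" for a
    by (simp flip: fps_exp_add_mult)
  have "(H z oo - fps_X) * (fps_exp (-1) - 1) = - fps_X * fps_exp (- z)"
    using arg_cong[OF H, of "\<lambda>f. f oo - fps_X" z]
    by (simp add: fps_compose_mult_distrib fps_compose_sub_distrib)
  hence "fps_exp 1 * ((H z oo - fps_X) * (fps_exp (-1) - 1)) = fps_exp 1 * (- fps_X * fps_exp (- z))"
    by (rule arg_cong)
  moreover have "fps_exp 1 * ((H z oo - fps_X) * (fps_exp (-1) - 1)) =
                 (H z oo - fps_X) * (fps_exp 1 * fps_exp (-1) - fps_exp 1)"
    by (simp only: right_diff_distrib mult_1_left mult_1_right mult_ac)
  moreover have "fps_exp 1 * (- fps_X * fps_exp (- z)) = - (fps_X * fps_exp (1 - z))"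
    using fps_exp_add_mult[of 1 "- z"] by (simp add: mult_ac)
  ultimately have "(H z oo - fps_X) * (1 - fps_exp 1) = - (fps_X * fps_exp (1 - z))"
    by (simp only: exp_neg)
  hence "(H z oo - fps_X) * (fps_exp 1 - 1) = fps_X * fps_exp (1 - z)"
    by (simp add: algebra_simps)
  hence "(H z oo - fps_X) * (fps_exp 1 - 1) = H (1 - z) * (fps_exp 1 - 1)"
    by (simp only: H)
  hence "H (1 - z) = (H z oo - fps_X)"
    using fps_exp_1_minus_1(2) by (metis mult_cancel_right)
  hence "fps_nth (H (1 - z)) r = (-1) ^ r * fps_nth (H z) r"
    by (simp add: fps_compose_uminus')
  thus ?thesis
    by (simp add: poly_bernoulli_poly H_def)
qed

text \<open>
  Reflection at \<open>1/2\<close> turns \<open>G = bernoulli_tail z k\<close> into \<open>(-1)\<^sup>k\<^sup>+\<^sup>1 G(-x)\<close>, so the coefficient of \<open>G\<^sup>m\<close> at \<open>N\<close> acquires the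
  sign \<open>(-1)\<^bsup>(k+1)m+N\<^esup>\<close>. For \<open>N = (k + 1)(n - m) + k\<close> this exponent does not depend on \<open>m\<close>.
\<close>

lemma poly_S_poly_reflect:
  "poly (S_poly n k) (1 - z) = (-1) ^ ((k + 1) * (n + 1) - 1) * poly (S_poly n k) z"
proof -
  have tail: "bernoulli_tail (1 - z) k = fps_const ((-1) ^ (k + 1)) * (bernoulli_tail z k oo - fps_X)"
    by (rule fps_ext)
       (simp add: bernoulli_tail_def fps_compose_uminus' poly_bernoulli_poly_reflect power_add)
  have "fps_nth (bernoulli_tail (1 - z) k ^ m) ((k + 1) * (n - m) + k) =
        (-1) ^ ((k + 1) * (n + 1) - 1) * fps_nth (bernoulli_tail z k ^ m) ((k + 1) * (n - m) + k)"
    if "m \<in> {1..n}" for m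
  proof -
    let ?N = "(k + 1) * (n - m) + k"
    have "bernoulli_tail (1 - z) k ^ m =
            fps_const ((-1) ^ ((k + 1) * m)) * (bernoulli_tail z k ^ m oo - fps_X)"
      by (simp only: tail power_mult_distrib fps_const_power power_mult)
         (simp add: fps_compose_power)
    hence "fps_nth (bernoulli_tail (1 - z) k ^ m) ?N =
           (-1) ^ ((k + 1) * m) * ((-1) ^ ?N * fps_nth (bernoulli_tail z k ^ m) ?N)"
      by (simp add: fps_compose_uminus')
    also have "\<dots> = (-1) ^ ((k + 1) * m + ?N) * fps_nth (bernoulli_tail z k ^ m) ?N"
      by (simp only: power_add mult.assoc)
    also have "(k + 1) * m + ?N = (k + 1) * (m + (n - m)) + k"
      by (simp only: distrib_left add.assoc)
    also have "\<dots> = (k + 1) * (n + 1) - 1"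
      using that by simp
    finally show ?thesis .
  qed
  thus ?thesis
    unfolding poly_S_poly sum_distrib_left by (intro sum.cong refl) (simp add: mult_ac)
qed

section \<open>Rational roots and divisibility\<close>

lemma prod_linear_dvd_poly:
  fixes p :: "'a :: field poly" and r :: "'b \<Rightarrow> 'a"
  assumes "finite A" "inj_on r A" "\<And>x. x \<in> A \<Longrightarrow> poly p (r x) = 0"
  shows   "(\<Prod>x\<in>A. [:- r x, 1:]) dvd p"
  using assms
proof (induction A)
  case (insert x A)
  then obtain q where q: "p = (\<Prod>x\<in>A. [:- r x, 1:]) * q"
    by auto
  have "poly (\<Prod>x\<in>A. [:- r x, 1:]) (r x) \<noteq> 0"
    using insert by (auto simp: poly_prod inj_on_def)
  moreover have "poly p (r x) = 0"
    using insert by auto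
  ultimately have "[:- r x, 1:] dvd q"
    by (simp add: q poly_eq_0_iff_dvd)
  thus ?case
    using insert.hyps unfolding q prod.insert[OF insert.hyps]
    by (metis mult.commute mult_dvd_mono dvd_refl)
qed auto

lemma poly_S_poly_root:
  assumes "k \<ge> 1" "j \<le> n + 1"
  shows   "poly (S_poly n k) (of_nat j / of_nat (n + 1)) = 0"
proof -
  have *: "poly (S_poly n k) (of_nat i / of_nat (n + 1)) = 0" if "i \<le> n" for i
  proof -
    let ?z = "of_nat i / of_nat (n + 1) :: rat"
    have "of_nat (n + 1) * ?z = of_nat i"
      using of_nat_neq_0[of n, where ?'a = rat] by (simp del: of_nat_Suc)
    hence "(-1) ^ (k * (n + 1)) * fact k * poly (S_poly n k) ?z = 0"
      using residue_higher_deriv_exp_recip_expm1_power[of n ?z i k] residue_eq_poly_S_poly[of k ?z n]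
        that \<open>k \<ge> 1\<close> by (simp only:)
    thus ?thesis
      by simp
  qed
  show ?thesis
  proof (cases "j = n + 1")
    case True
    thus ?thesis
      using poly_S_poly_reflect[of n k 0] *[of 0] by simp
  qed (use * assms in auto)
qed

theorem theorem1:
  fixes n k :: nat
  assumes "n \<ge> 1" and "k \<ge> 1"
  shows "pcompose (S_poly n k) [:1, -1:] = (-1) ^ ((k + 1) * (n + 1) - 1) * S_poly n k
       \<and> [:0, 1:] * (\<Prod>j=1..n+1. [:- of_nat j, of_nat (n + 1):]) dvd S_poly n k"
proof
  have "poly (pcompose (S_poly n k) [:1, -1:]) z =
        poly ((-1) ^ ((k + 1) * (n + 1) - 1) * S_poly n k) z" for z
    using poly_S_poly_reflect[of n k z] by (simp add: poly_pcompose)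
  thus "pcompose (S_poly n k) [:1, -1:] = (-1) ^ ((k + 1) * (n + 1) - 1) * S_poly n k"
    by (intro poly_eq_poly_eq_iff[THEN iffD1] ext)
next
  let ?c = "of_nat (n + 1) :: rat"
  let ?r = "\<lambda>j. of_nat j / ?c"
  have c: "?c \<noteq> 0"
    by (simp del: of_nat_add of_nat_Suc)
  have "(\<Prod>j=1..n+1. [:- of_nat j, ?c:]) = (\<Prod>j=1..n+1. smult ?c [:- ?r j, 1:])"
    using c by simp
  also have "\<dots> = smult (?c ^ (n + 1)) (\<Prod>j=1..n+1. [:- ?r j, 1:])"
    by (simp only: prod_smult) simp
  \<comment> \<open>The factor \<open>z\<close> is the linear factor that belongs to \<open>j = 0\<close>.\<close>
  finally have "[:0, 1:] * (\<Prod>j=1..n+1. [:- of_nat j, ?c:]) =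
      smult (?c ^ (n + 1)) ([:- ?r 0, 1:] * (\<Prod>j=1..n+1. [:- ?r j, 1:]))"
    by simp
  also have "[:- ?r 0, 1:] * (\<Prod>j=1..n+1. [:- ?r j, 1:]) = (\<Prod>j=0..n+1. [:- ?r j, 1:])"
    by (subst (2) prod.atLeast_Suc_atMost) simp_all
  finally have "[:0, 1:] * (\<Prod>j=1..n+1. [:- of_nat j, ?c:]) =
      smult (?c ^ (n + 1)) (\<Prod>j=0..n+1. [:- ?r j, 1:])" .
  moreover have "(\<Prod>j=0..n+1. [:- ?r j, 1:]) dvd S_poly n k"
    using c poly_S_poly_root[OF \<open>k \<ge> 1\<close>] by (intro prod_linear_dvd_poly) (auto simp: inj_on_def)
  ultimately show "[:0, 1:] * (\<Prod>j=1..n+1. [:- of_nat j, ?c:]) dvd S_poly n k"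
    using c by (simp add: smult_dvd_iff)
qed

end
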